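(* For all integers $r\ge k\ge 2$, every integer $\Delta>0$ and every $\alpha>0$, there exists $n_0$ such that for all $n\ge n_0$ the following holds. Put $r':=36(r+1)(k-1)\Delta$. Let $G$ be any $n$-vertex $k$-graph with $\mathrm{tw}(G)<r$ and $\Delta_1(G)\le\Delta$, and let $H$ be any $n$-vertex $k$-graph with $$\delta(H)\ \ge\ \left(1-\frac{1}{\binom{r'-1}{k-1}+\binom{r'-2}{k-2}}+\alpha\right)n.$$ Then $G\subseteq H$, i.e. $H$ contains a copy of $G$ as a subgraph.
   Context: A $k$-graph is a $k$-uniform hypergraph. For a $k$-graph $H$, the minimum codegree $\delta(H)$ is the maximum number $m$ such that each set of $k-1$ vertices of $H$ lies in at least $m$ edges of $H$. $\Delta_1(G)$ denotes the maximum vertex degree of $G$, i.e. the maximum number of edges of $G$ containing a given vertex. For a hypergraph $F$ and $j\ge1$, the $j$th shadow $\partial_j(F)$ is the $j$-graph on $V(F)$ whose edges are the $j$-sets contained in some edge of $F$. An $s$-uniform hypergraph $T$ is an $s$-tree if (i) $T$ consists of a single edge, or (ii) there exist an $s$-tree $T'$, a set $X\in\partial_{s-1}(T')$ and a vertex $v\notin V(T')$ such that $T$ is obtained from $T'$ by adding $v$ and the edge $X\cup\{v\}$. The tree-width $\mathrm{tw}(G)$ of a $k$-graph $G$ is the minimum $s$ such that there is an $(s+1)$-tree $T$ with $G\subseteq\partial_k(T)$. *)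

theory Defs
  imports Complex_Main
begin

datatype 'a hypergraph = Hypergraph (verts: "'a set") (edges: "'a set set")

definition kgraph :: "nat \<Rightarrow> 'a hypergraph \<Rightarrow> bool" where
  "kgraph k G \<longleftrightarrow> finite (verts G) \<and> (\<forall>e\<in>edges G. e \<subseteq> verts G \<and> card e = k)"

text \<open>The relation written \<open>G \<subseteq> H\<close> for hypergraphs: \<open>H\<close> contains a (not necessarily induced) copy
  of \<open>G\<close>. The two hypergraphs may have different vertex types.\<close>

definition contains_copy :: "'b hypergraph \<Rightarrow> 'a hypergraph \<Rightarrow> bool" where
  "contains_copy H G \<longleftrightarrow>
     (\<exists>f. inj_on f (verts G) \<and> f ` verts G \<subseteq> verts H \<and> (\<forall>e\<in>edges G. f ` e \<in> edges H))"

definition degree :: "'a hypergraph \<Rightarrow> 'a set \<Rightarrow> nat" where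
  "degree G S = card {e \<in> edges G. S \<subseteq> e}"

definition max_degree :: "'a hypergraph \<Rightarrow> nat" where
  "max_degree G = Max ((\<lambda>v. degree G {v}) ` verts G)"

text \<open>Only meaningful for at least \<open>k - 1\<close> vertices: otherwise every \<open>m\<close> qualifies vacuously and
  there is no maximum. Likewise \<^const>\<open>max_degree\<close> needs a vertex.\<close>

definition min_codegree :: "nat \<Rightarrow> 'a hypergraph \<Rightarrow> nat" where
  "min_codegree k H =
     (GREATEST m. \<forall>S. S \<subseteq> verts H \<and> card S = k - 1 \<longrightarrow> m \<le> degree H S)"

definition shadow :: "nat \<Rightarrow> 'a hypergraph \<Rightarrow> 'a hypergraph" where
  "shadow j F = Hypergraph (verts F) {X. card X = j \<and> (\<exists>e\<in>edges F. X \<subseteq> e)}"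

text \<open>For \<open>s = 1\<close>, the rule \<open>extend\<close> uses the \<open>0\<close>th shadow, whose only edge is the empty set;
  so a \<open>1\<close>-tree is a nonempty finite set of singleton edges.\<close>

inductive hypertree :: "nat \<Rightarrow> 'a hypergraph \<Rightarrow> bool" for s :: nat where
  single: "s \<ge> 1 \<Longrightarrow> finite e \<Longrightarrow> card e = s \<Longrightarrow> hypertree s (Hypergraph e {e})"
| extend: "hypertree s T \<Longrightarrow> X \<in> edges (shadow (s - 1) T) \<Longrightarrow> v \<notin> verts T \<Longrightarrow>
     hypertree s (Hypergraph (insert v (verts T)) (insert (insert v X) (edges T)))"

text \<open>The host tree lives on natural numbers, not on the vertex type of \<open>G\<close>, so that its size is
  not limited by a finite vertex type. As trees are finite, this loses no generality.\<close>

definition treewidth :: "nat \<Rightarrow> 'a hypergraph \<Rightarrow> nat" where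
  "treewidth k G =
     (LEAST s. \<exists>T :: nat hypergraph. hypertree (s + 1) T \<and> contains_copy (shadow k T) G)"

text \<open>\<^const>\<open>treewidth\<close> and \<^const>\<open>min_codegree\<close> are genuine extrema.\<close>

lemma treewidth_attained:
  assumes "kgraph k G"
  shows "\<exists>T :: nat hypergraph. hypertree (treewidth k G + 1) T \<and> contains_copy (shadow k T) G"
proof -
  define n where "n = card (verts G)"
  define T where "T = Hypergraph {..<n - 1 + 1} {{..<n - 1 + 1 :: nat}}"
  have fin: "finite (verts G)" using assms by (simp add: kgraph_def)
  obtain f where f: "bij_betw f (verts G) {0..<n}"
    using ex_bij_betw_finite_nat[OF fin] unfolding n_def by blast
  then have inj: "inj_on f (verts G)" and img: "f ` verts G = {0..<n}"
    by (auto simp: bij_betw_def)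
  have "hypertree (n - 1 + 1) T"
    unfolding T_def by (rule hypertree.single) auto
  moreover have "contains_copy (shadow k T) G"
    unfolding contains_copy_def
  proof (intro exI conjI ballI)
    show "inj_on f (verts G)" by (rule inj)
    show "f ` verts G \<subseteq> verts (shadow k T)" by (auto simp: img shadow_def T_def)
    fix e assume e: "e \<in> edges G"
    then have sub: "e \<subseteq> verts G" and "card e = k" using assms by (auto simp: kgraph_def)
    then have "card (f ` e) = k" using card_image inj_on_subset[OF inj] by metis
    moreover have "f ` e \<subseteq> {..<n - 1 + 1}" using image_mono[OF sub, of f] by (auto simp: img)
    ultimately show "f ` e \<in> edges (shadow k T)" by (auto simp: shadow_def T_def)
  qed
  ultimately show ?thesis
    unfolding treewidth_def by (intro LeastI_ex[where P = "\<lambda>s. \<exists>T :: nat hypergraph. hypertree (s + 1) T \<and> contains_copy (shadow k T) G"] exI[of _ "n - 1"] exI[of _ T] conjI)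
qed

lemma min_codegree_greatest:
  assumes "kgraph k H" "k - 1 \<le> card (verts H)"
  shows "m \<le> min_codegree k H \<longleftrightarrow>
    (\<forall>S. S \<subseteq> verts H \<and> card S = k - 1 \<longrightarrow> m \<le> degree H S)"
proof -
  let ?P = "\<lambda>m. \<forall>S. S \<subseteq> verts H \<and> card S = k - 1 \<longrightarrow> m \<le> degree H S"
  obtain S where S: "S \<subseteq> verts H" "card S = k - 1"
    using obtain_subset_with_card_n[OF assms(2)] by metis
  then have bound: "\<And>y. ?P y \<Longrightarrow> y \<le> degree H S" by blast
  have "?P 0" by simp
  then have attained: "?P (min_codegree k H)"
    unfolding min_codegree_def by (rule GreatestI_nat[where P = ?P]) (rule bound)
  have "m \<le> min_codegree k H" if "?P m"
    unfolding min_codegree_def using that by (rule Greatest_le_nat[where P = ?P]) (rule bound)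
  moreover have "?P m" if "m \<le> min_codegree k H"
    using attained that by (meson le_trans)
  ultimately show ?thesis by (rule iffI[rotated])
qed

end

theory Submission
  imports Defs "HOL-Library.FuncSet" "HOL-Combinatorics.Permutations"
begin

text \<open>
  The codegree of \<open>H\<close> is so large that a random bijection is a copy of \<open>G\<close> with positive
  probability. For an edge \<open>e\<close> of \<open>G\<close> and a non-edge \<open>g\<close> of \<open>H\<close>, the bad event \<open>f ` e = g\<close> has
  probability \<open>1 / (n choose k)\<close>. Postcomposing with a permutation that moves \<open>g\<close> to another \<open>k\<close>-set shows that
  it is negatively correlated with the avoidance of bad events \<open>(e', g')\<close> with \<open>e \<inter> e' = {}\<close> and
  \<open>g \<inter> g' = {}\<close>. If \<open>(k - 1)\<close>-sets lie in at most \<open>c\<close> non-edges, then each bad event conflicts with at most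
  \<open>2 * \<Delta> * c * (n choose (k - 1))\<close> others, so the lopsided Lovasz local lemma
  applies as soon as \<open>8 * \<Delta> * c * k \<le> n - k + 1\<close>.
\<close>

section \<open>The lopsided local lemma in counting form\<close>

text \<open>Probabilities are ratios of cardinalities in \<open>\<Omega>\<close>. Independence is
  weakened to a one-sided bound: avoiding events that do not conflict with \<open>i\<close> leaves
  the conditional probability of \<open>A i\<close> at most \<open>p i\<close>. Induction on the
  conditioning set shows that avoiding arbitrary events raises this bound by a factor of at most
  2.\<close>

lemma lopsided_local_lemma:
  fixes A :: "'i \<Rightarrow> 'w set" and p :: "'i \<Rightarrow> real" and conflict :: "'i \<Rightarrow> 'i \<Rightarrow> bool"
  assumes fin: "finite \<Omega>" "finite I" and ne: "\<Omega> \<noteq> {}"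
    and p: "\<And>i. i \<in> I \<Longrightarrow> 0 \<le> p i \<and> p i \<le> 1/4"
    and lop: "\<And>i S. i \<in> I \<Longrightarrow> S \<subseteq> I \<Longrightarrow> \<forall>j\<in>S. \<not> conflict i j \<Longrightarrow>
       real (card (A i \<inter> (\<Omega> - \<Union>(A ` S)))) \<le> p i * real (card (\<Omega> - \<Union>(A ` S)))"
    and sum: "\<And>i. i \<in> I \<Longrightarrow> (\<Sum>j | j \<in> I \<and> conflict i j. p j) \<le> 1/4"
  shows "\<Omega> - \<Union>(A ` I) \<noteq> {}"
proof -
  define N where "N S = \<Omega> - \<Union>(A ` S)" for S
  have finN [simp]: "finite (N S)" for S using fin by (simp add: N_def)
  have cond: "real (card (A i \<inter> N S)) \<le> 2 * p i * real (card (N S))"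
    if "S \<subseteq> I" "i \<in> I" for S i
  proof -
    have "finite S" using that fin finite_subset by blast
    then show ?thesis using that
    proof (induction S arbitrary: i rule: finite_psubset_induct)
      case (psubset S)
      define S1 where "S1 = {j \<in> S. conflict i j}"
      define S2 where "S2 = S - S1"
      have finS1: "finite S1" using psubset.hyps by (simp add: S1_def)
      have lop2: "real (card (A i \<inter> N S2)) \<le> p i * real (card (N S2))"
        unfolding N_def using psubset.prems by (intro lop) (auto simp: S2_def S1_def)
      have half: "real (card (N S2)) \<le> 2 * real (card (N S))"
      proof (cases "S1 = {}")
        case True
        then show ?thesis by (simp add: S2_def)
      next
        case False
        then have ss: "S2 \<subset> S" by (auto simp: S2_def S1_def)
        have "N S2 \<subseteq> N S \<union> (\<Union>j\<in>S1. A j \<inter> N S2)"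
          by (auto simp: N_def S2_def)
        then have "card (N S2) \<le> card (N S \<union> (\<Union>j\<in>S1. A j \<inter> N S2))"
          using finS1 by (intro card_mono) auto
        also have "\<dots> \<le> card (N S) + card (\<Union>j\<in>S1. A j \<inter> N S2)"
          by (rule card_Un_le)
        also have "\<dots> \<le> card (N S) + (\<Sum>j\<in>S1. card (A j \<inter> N S2))"
          by (intro add_left_mono card_UN_le finS1)
        finally have "real (card (N S2)) \<le> real (card (N S)) + (\<Sum>j\<in>S1. real (card (A j \<inter> N S2)))"
          by (metis of_nat_add of_nat_le_iff of_nat_sum)
        also have "(\<Sum>j\<in>S1. real (card (A j \<inter> N S2))) \<le> (\<Sum>j\<in>S1. 2 * p j * real (card (N S2)))"
          using psubset.prems ss by (intro sum_mono psubset.IH) (auto simp: S1_def)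
        also have "\<dots> = 2 * (\<Sum>j\<in>S1. p j) * real (card (N S2))"
          by (simp add: sum_distrib_left sum_distrib_right)
        also have "(\<Sum>j\<in>S1. p j) \<le> (\<Sum>j | j \<in> I \<and> conflict i j. p j)"
          using fin psubset.prems p by (intro sum_mono2) (auto simp: S1_def)
        also have "\<dots> \<le> 1/4" using psubset.prems sum by blast
        finally show ?thesis by (simp add: mult_right_mono)
      qed
      have "card (A i \<inter> N S) \<le> card (A i \<inter> N S2)"
        by (intro card_mono finite_Int) (auto simp: N_def S2_def fin)
      then have "real (card (A i \<inter> N S)) \<le> p i * real (card (N S2))"
        using lop2 by linarith
      also have "\<dots> \<le> p i * (2 * real (card (N S)))"
        using half p psubset.prems by (intro mult_left_mono) auto
      finally show ?case by simp
    qed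
  qed
  \<comment> \<open>Events are added one at a time; since \<open>p i\<close> is at most 1/4, each
    removes at most half of what is left.\<close>
  have "N S \<noteq> {}" if "S \<subseteq> I" for S
  proof -
    have "finite S" using that fin finite_subset by blast
    then show ?thesis using that
    proof (induction S)
      case empty
      then show ?case using ne by (simp add: N_def)
    next
      case (insert i S)
      then have pos: "card (N S) > 0" by (simp add: card_gt_0_iff)
      have "real (card (A i \<inter> N S)) \<le> 2 * p i * real (card (N S))"
        using insert.prems by (intro cond) auto
      also have "\<dots> \<le> 1/2 * real (card (N S))"
        using p[of i] insert.prems by (intro mult_right_mono) auto
      finally have "card (A i \<inter> N S) < card (N S)" using pos by simp
      moreover have "N S \<subseteq> A i \<inter> N S" if "N (insert i S) = {}"
        using that by (auto simp: N_def)
      ultimately show ?case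
        by (metis card_mono finN finite_Int leD)
    qed
  qed
  then show ?thesis by (simp add: N_def)
qed

section \<open>Negative correlation for uniformly random bijections\<close>

text \<open>A bijection from \<open>g\<close> to \<open>g'\<close> is glued to one from
  \<open>g' - g\<close> to \<open>g - g'\<close>. The small support matters: sets disjoint from
  \<open>g\<close> and \<open>g'\<close> stay fixed pointwise.\<close>

lemma permutes_mapping_set:
  assumes "finite g" "finite g'" "card g = card g'"
  obtains \<sigma> where "\<sigma> permutes (g \<union> g')" "\<sigma> ` g = g'"
proof -
  have "card (g - g') = card (g' - g)"
    using assms by (metis card_Diff_subset_Int finite_Int inf_commute)
  then obtain h1 where h1: "bij_betw h1 g g'" and "card (g' - g) = card (g - g')"
    using finite_same_card_bij[OF assms] by metis
  then obtain h2 where h2: "bij_betw h2 (g' - g) (g - g')"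
    using assms finite_same_card_bij by (metis finite_Diff)
  define \<sigma> where "\<sigma> x = (if x \<in> g then h1 x else if x \<in> g' then h2 x else x)" for x
  have b1: "bij_betw \<sigma> g g'"
    using h1 by (rule bij_betw_cong[THEN iffD1, rotated]) (simp add: \<sigma>_def)
  have b2: "bij_betw \<sigma> (g' - g) (g - g')"
    using h2 by (rule bij_betw_cong[THEN iffD1, rotated]) (simp add: \<sigma>_def)
  have "bij_betw \<sigma> (g \<union> (g' - g)) (g' \<union> (g - g'))"
    using b1 b2 by (rule bij_betw_combine) auto
  then have "bij_betw \<sigma> (g \<union> g') (g \<union> g')" by (simp add: Un_commute)
  then have "\<sigma> permutes (g \<union> g')"
    by (rule bij_imp_permutes) (simp add: \<sigma>_def)
  then show ?thesis using that b1 by (simp add: bij_betw_def)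
qed

text \<open>Extensionality makes each bijection of \<open>V\<close> onto \<open>W\<close> count
  exactly once, so cardinalities describe the uniform distribution.\<close>

definition bijections :: "'a set \<Rightarrow> 'b set \<Rightarrow> ('a \<Rightarrow> 'b) set" where
  "bijections V W = {f \<in> extensional V. bij_betw f V W}"

lemma finite_bijections:
  assumes "finite V" "finite W"
  shows "finite (bijections V W)"
proof (rule finite_subset)
  show "bijections V W \<subseteq> V \<rightarrow>\<^sub>E W"
    by (auto simp: bijections_def PiE_def bij_betw_def)
qed (use assms in \<open>simp add: finite_PiE\<close>)

lemma bijections_nonempty:
  assumes "finite V" "finite W" "card V = card W"
  shows "bijections V W \<noteq> {}"
proof -
  obtain h where "bij_betw h V W" using finite_same_card_bij[OF assms] by blast
  then have "restrict h V \<in> bijections V W"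
    by (simp add: bijections_def)
  then show ?thesis by blast
qed

text \<open>For each \<open>k\<close>-set \<open>g1\<close>, postcomposition with a permutation
  taking \<open>g\<close> to \<open>g1\<close> injects the maps in \<open>X\<close> with
  \<open>f\<close> e = g\<open>into those with\<close>f \<open>e = g1\<close>. The target classes
  are disjoint subsets of \<open>X\<close>, one for each of the \<open>card W choose k\<close>
  choices of \<open>g1\<close>.\<close>

lemma bijections_lopsided:
  fixes V :: "'a set" and W :: "'b set"
  assumes fin: "finite V" "finite W" and e: "e \<subseteq> V" "card e = k"
    and g: "g \<subseteq> W" "card g = k"
    and S: "\<forall>(e', g')\<in>S. e' \<subseteq> V \<and> g' \<subseteq> W \<and> e \<inter> e' = {} \<and> g \<inter> g' = {}"
  defines "X \<equiv> {f \<in> bijections V W. \<forall>(e', g')\<in>S. f ` e' \<noteq> g'}"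
  shows "(card W choose k) * card {f \<in> X. f ` e = g} \<le> card X"
proof -
  define P where "P = {g'. g' \<subseteq> W \<and> card g' = k}"
  have finP: "finite P" unfolding P_def using fin by simp
  have finX: "finite X" using finite_bijections[OF fin] by (simp add: X_def)
  have le: "card {f \<in> X. f ` e = g} \<le> card {f \<in> X. f ` e = g1}" if "g1 \<in> P" for g1
  proof -
    have g1: "g1 \<subseteq> W" "card g1 = k" using that by (auto simp: P_def)
    have "finite g" "finite g1" "card g = card g1"
      using g g1 fin(2) by (simp_all add: finite_subset)
    then obtain \<sigma> where \<sigma>: "\<sigma> permutes (g \<union> g1)" and img: "\<sigma> ` g = g1"
      by (rule permutes_mapping_set)
    have \<sigma>W: "\<sigma> permutes W" using permutes_subset[OF \<sigma>] g g1 by blast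
    define F where "F f = restrict (\<sigma> \<circ> f) V" for f :: "'a \<Rightarrow> 'b"
    have Fimg: "F f ` e' = \<sigma> ` f ` e'" if "e' \<subseteq> V" for f e'
      using that by (force simp: F_def)
    have "inj_on F {f \<in> X. f ` e = g}"
    proof (rule inj_onI)
      fix f f' assume f: "f \<in> {f \<in> X. f ` e = g}" "f' \<in> {f \<in> X. f ` e = g}" and eq: "F f = F f'"
      have "f x = f' x" if "x \<in> V" for x
        using fun_cong[OF eq, of x] that injD[OF permutes_inj[OF \<sigma>]] by (simp add: F_def)
      then show "f = f'"
        using f by (intro extensionalityI[of f V f']) (auto simp: X_def bijections_def)
    qed
    moreover have "F f \<in> {f \<in> X. f ` e = g1}" if f: "f \<in> {f \<in> X. f ` e = g}" for f
    proof -
      have bf: "bij_betw f V W" and fe: "f ` e = g" using f by (auto simp: X_def bijections_def)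
      have "bij_betw (\<sigma> \<circ> f) V W"
        using bf permutes_imp_bij[OF \<sigma>W] by (rule bij_betw_trans)
      then have Fb: "F f \<in> bijections V W" by (simp add: F_def bijections_def)
      have Fe: "F f ` e = g1" using Fimg[OF e(1)] fe img by simp
      \<comment> \<open>If the new map hit a forbidden \<open>g'\<close>, then \<open>g'\<close>
        would miss \<open>g1\<close> by injectivity and \<open>g\<close> by assumption. So
        \<open>\<sigma>\<close> would fix it pointwise, and \<open>f\<close> would already map
        \<open>e'\<close> to \<open>g'\<close>.\<close>
      have "F f ` e' \<noteq> g'" if m: "(e', g') \<in> S" for e' g'
      proof
        assume a: "F f ` e' = g'"
        have d: "e' \<subseteq> V" "e \<inter> e' = {}" "g \<inter> g' = {}" using S m by auto
        have inj: "inj_on (F f) V" using Fb by (simp add: bijections_def bij_betw_def)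
        have "F f ` e \<inter> F f ` e' = {}"
          using inj_on_image_Int[OF inj e(1) d(1)] d(2) by simp
        then have "g1 \<inter> g' = {}" using Fe a by simp
        then have fix_g': "\<sigma> y = y" if "y \<in> g'" for y
          using that d(3) by (intro permutes_not_in[OF \<sigma>]) auto
        have "\<sigma> ` f ` e' = \<sigma> ` g'" using a Fimg[OF d(1)] fix_g' by simp
        then have "f ` e' = g'" using permutes_inj[OF \<sigma>] by (simp add: inj_image_eq_iff)
        then show False using f m by (auto simp: X_def)
      qed
      then show ?thesis using Fb Fe by (auto simp: X_def)
    qed
    ultimately show ?thesis
      using finX by (intro card_inj_on_le[of F]) auto
  qed
  have "(card W choose k) * card {f \<in> X. f ` e = g} = (\<Sum>g1\<in>P. card {f \<in> X. f ` e = g})"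
    using n_subsets[OF fin(2), of k] by (simp add: P_def)
  also have "\<dots> \<le> (\<Sum>g1\<in>P. card {f \<in> X. f ` e = g1})"
    by (intro sum_mono le)
  also have "\<dots> = card (\<Union>g1\<in>P. {f \<in> X. f ` e = g1})"
    using finP finX by (intro card_UN_disjoint[symmetric]) auto
  also have "\<dots> \<le> card X" using finX by (intro card_mono) auto
  finally show ?thesis .
qed

section \<open>Double counting in uniform set systems\<close>

lemma card_sets_between:
  assumes "finite g" "U \<subseteq> g" "card U \<le> m"
  shows "card {S. U \<subseteq> S \<and> S \<subseteq> g \<and> card S = m} = (card g - card U) choose (m - card U)"
proof -
  have finU: "finite U" using assms finite_subset by blast
  have "bij_betw (\<lambda>S. S - U) {S. U \<subseteq> S \<and> S \<subseteq> g \<and> card S = m}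
      {T. T \<subseteq> g - U \<and> card T = m - card U}"
  proof (rule bij_betw_byWitness[where f' = "\<lambda>T. T \<union> U"])
    show "(\<lambda>S. S - U) ` {S. U \<subseteq> S \<and> S \<subseteq> g \<and> card S = m} \<subseteq> {T. T \<subseteq> g - U \<and> card T = m - card U}"
      using finU by (auto simp: card_Diff_subset)
    show "(\<lambda>T. T \<union> U) ` {T. T \<subseteq> g - U \<and> card T = m - card U} \<subseteq> {S. U \<subseteq> S \<and> S \<subseteq> g \<and> card S = m}"
    proof clarsimp
      fix T assume T: "T \<subseteq> g - U" "card T = m - card U"
      then have "card (T \<union> U) = card T + card U"
        using assms finU finite_subset[of T g] by (intro card_Un_disjoint) auto
      then show "T \<subseteq> g \<and> U \<subseteq> g \<and> card (T \<union> U) = m" using T assms by auto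
    qed
  qed auto
  then have "card {S. U \<subseteq> S \<and> S \<subseteq> g \<and> card S = m} = card {T. T \<subseteq> g - U \<and> card T = m - card U}"
    by (rule bij_betw_same_card)
  also have "\<dots> = card (g - U) choose (m - card U)"
    using assms by (intro n_subsets) simp
  finally show ?thesis using assms finU by (simp add: card_Diff_subset)
qed

text \<open>Double counting of pairs \<open>U \<subseteq> S \<subseteq> g\<close> with
  \<open>card S = k - 1\<close> and \<open>g\<close> in \<open>N\<close>: each \<open>g\<close>
  contains \<open>k - card U\<close> such \<open>S\<close>, and each \<open>S\<close> lies in at
  most \<open>c\<close> such \<open>g\<close>. Empty \<open>U\<close> bounds \<open>card N\<close>;
  singletons bound vertex degrees.\<close>

lemma degree_le_of_codegree:
  assumes fin: "finite W" and N: "\<forall>g\<in>N. g \<subseteq> W \<and> card g = k"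
    and cod: "\<And>S. S \<subseteq> W \<Longrightarrow> card S = k - 1 \<Longrightarrow> card {g\<in>N. S \<subseteq> g} \<le> c"
    and U: "U \<subseteq> W" "card U < k"
  shows "(k - card U) * card {g\<in>N. U \<subseteq> g} \<le> (card W - card U choose (k - 1 - card U)) * c"
proof -
  define P where "P = {S. U \<subseteq> S \<and> S \<subseteq> W \<and> card S = k - 1}"
  have finN: "finite N" by (rule finite_subset[of _ "Pow W"]) (use N fin in auto)
  have finP: "finite P" by (rule finite_subset[of _ "Pow W"]) (use fin in \<open>auto simp: P_def\<close>)
  have cnt: "card {S \<in> P. S \<subseteq> g} = k - card U" if "g \<in> {g\<in>N. U \<subseteq> g}" for g
  proof -
    have g: "U \<subseteq> g" "g \<subseteq> W" "card g = k" using that N by auto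
    have "finite g" using g(2) fin by (rule finite_subset)
    have "{S \<in> P. S \<subseteq> g} = {S. U \<subseteq> S \<and> S \<subseteq> g \<and> card S = k - 1}"
      using g by (auto simp: P_def)
    then have "card {S \<in> P. S \<subseteq> g} = (k - card U) choose (k - 1 - card U)"
      using card_sets_between[OF \<open>finite g\<close>, of U "k - 1"] g U by simp
    also have "\<dots> = (Suc (k - 1 - card U)) choose (k - 1 - card U)"
      using U by (intro arg_cong2[of _ _ _ _ binomial]) auto
    also have "\<dots> = k - card U" unfolding binomial_Suc_n using U by auto
    finally show ?thesis .
  qed
  have "(k - card U) * card {g\<in>N. U \<subseteq> g} = (\<Sum>g | g \<in> N \<and> U \<subseteq> g. card {S \<in> P. S \<subseteq> g})"
    using cnt by simp
  also have "\<dots> = (\<Sum>S\<in>P. card {g \<in> {g\<in>N. U \<subseteq> g}. S \<subseteq> g})"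
    using finN finP by (intro sum_multicount_gen[symmetric]) auto
  also have "\<dots> \<le> (\<Sum>S\<in>P. c)"
  proof (rule sum_mono)
    fix S assume "S \<in> P"
    then have "card {g \<in> N. S \<subseteq> g} \<le> c" using cod by (auto simp: P_def)
    moreover have "card {g \<in> {g\<in>N. U \<subseteq> g}. S \<subseteq> g} \<le> card {g \<in> N. S \<subseteq> g}"
      using finN by (intro card_mono) auto
    ultimately show "card {g \<in> {g\<in>N. U \<subseteq> g}. S \<subseteq> g} \<le> c" by linarith
  qed
  also have "\<dots> = (card W - card U choose (k - 1 - card U)) * c"
    using card_sets_between[OF fin U(1), of "k - 1"] U by (simp add: P_def)
  finally show ?thesis .
qed

text \<open>A union bound over the points of \<open>g\<close>. The factor \<open>m\<close> lets
  degree bounds be used without division.\<close>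

lemma card_meeting_le:
  assumes "finite g" and "\<And>w. w \<in> g \<Longrightarrow> m * card {g'\<in>N. w \<in> g'} \<le> d"
  shows "m * card {g'\<in>N. g \<inter> g' \<noteq> {}} \<le> card g * d"
proof -
  have "{g'\<in>N. g \<inter> g' \<noteq> {}} = (\<Union>w\<in>g. {g'\<in>N. w \<in> g'})" by auto
  also have "card \<dots> \<le> (\<Sum>w\<in>g. card {g'\<in>N. w \<in> g'})"
    using assms(1) by (rule card_UN_le)
  finally have "m * card {g'\<in>N. g \<inter> g' \<noteq> {}} \<le> m * (\<Sum>w\<in>g. card {g'\<in>N. w \<in> g'})"
    by (rule mult_le_mono2)
  also have "\<dots> = (\<Sum>w\<in>g. m * card {g'\<in>N. w \<in> g'})" by (rule sum_distrib_left)
  also have "\<dots> \<le> (\<Sum>w\<in>g. d)" using assms(2) by (intro sum_mono)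
  finally show ?thesis by simp
qed

section \<open>Packing two uniform set systems by the local lemma\<close>

text \<open>The bad events are indexed by \<open>E \<times> N\<close> and all get the bound
  \<open>p = 1 / (n choose k)\<close>. \<open>small\<close> says that four times the number of
  conflicts is at most \<open>n choose k\<close>; its additive form avoids truncated subtraction.
  \<open>kn\<close> is separate because \<open>small\<close> alone admits \<open>k = n + 1\<close>,
  where \<open>n choose k\<close> is 0.\<close>

theorem hypergraph_packing:
  fixes V :: "'a set" and W :: "'b set"
  assumes k: "k \<ge> 2" and fin: "finite V" "finite W" and card: "card V = n" "card W = n"
    and E: "\<forall>e\<in>E. e \<subseteq> V \<and> card e = k"
    and N: "\<forall>g\<in>N. g \<subseteq> W \<and> card g = k"
    and deg: "\<And>v. v \<in> V \<Longrightarrow> card {e\<in>E. v \<in> e} \<le> \<Delta>"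
    and cod: "\<And>S. S \<subseteq> W \<Longrightarrow> card S = k - 1 \<Longrightarrow> card {g\<in>N. S \<subseteq> g} \<le> c"
    and small: "8 * \<Delta> * c * k + k \<le> n + 1" and kn: "k \<le> n"
  shows "\<exists>f. bij_betw f V W \<and> (\<forall>e\<in>E. f ` e \<notin> N)"
proof -
  have finE: "finite E" by (rule finite_subset[of _ "Pow V"]) (use E fin in auto)
  have finN: "finite N" by (rule finite_subset[of _ "Pow W"]) (use N fin in auto)
  define B where "B = n choose (k - 1)"
  define \<Omega> where "\<Omega> = bijections V W"
  define A where "A = (\<lambda>(e, g). {f \<in> \<Omega>. f ` e = g})"
  define conflict :: "'a set \<times> 'b set \<Rightarrow> 'a set \<times> 'b set \<Rightarrow> bool" where
    "conflict = (\<lambda>(e, g) (e', g'). e \<inter> e' \<noteq> {} \<or> g \<inter> g' \<noteq> {})"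
  define p where "p = 1 / real (n choose k)"
  have nk: "n choose k > 0" using kn by simp
  have N_card: "k * card N \<le> B * c"
    using degree_le_of_codegree[OF fin(2) N cod, of "{}"] k by (simp add: card B_def)
  have N_deg: "(k - 1) * card {g'\<in>N. w \<in> g'} \<le> (n - 1 choose (k - 2)) * c" if "w \<in> W" for w
    using degree_le_of_codegree[OF fin(2) N cod, of "{w}"] k that
    by (simp add: card numeral_2_eq_2)
  have E_card: "k * card E \<le> \<Delta> * n"
  proof -
    have "k * card E = (\<Sum>e\<in>E. card {v\<in>V. v \<in> e})"
    proof -
      have "card {v\<in>V. v \<in> e} = k" if "e \<in> E" for e
      proof -
        have "{v\<in>V. v \<in> e} = e" using E that by auto
        then show ?thesis using E that by simp
      qed
      then show ?thesis by simp
    qed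
    also have "\<dots> = (\<Sum>v\<in>V. card {e\<in>E. v \<in> e})"
      using finE fin by (intro sum_multicount_gen[symmetric]) auto
    also have "\<dots> \<le> (\<Sum>v\<in>V. \<Delta>)" by (intro sum_mono deg)
    finally show ?thesis using card by (simp add: mult.commute)
  qed
  \<comment> \<open>Absorption expresses the degree bound for \<open>N\<close> through
    \<open>B\<close>, so that both kinds of conflict are measured in the same unit.\<close>
  have absorb: "(k - 1) * B = n * (n - 1 choose (k - 2))"
    using times_binomial_minus1_eq[of "k - 1" n] k by (simp add: B_def numeral_2_eq_2)
  have choose: "k * (n choose k) = (n - (k - 1)) * B"
  proof -
    have "Suc (k - 1) * (n choose Suc (k - 1)) = (n - (k - 1)) * (n choose (k - 1))"
      by (metis binomial_absorption binomial_absorb_comp)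
    then show ?thesis using k by (simp add: B_def)
  qed
  \<comment> \<open>A conflicting pair has an edge meeting \<open>e\<close> or a non-edge meeting
    \<open>g\<close>. Each kind contributes at most \<open>\<Delta> * c * B\<close>.\<close>
  have few: "4 * card {j \<in> E \<times> N. conflict (e, g) j} \<le> n choose k" if "e \<in> E" "g \<in> N" for e g
  proof -
    have e: "e \<subseteq> V" "card e = k" and g: "g \<subseteq> W" "card g = k"
      using that E N by auto
    have fin_eg: "finite e" "finite g"
      using e(1) g(1) fin finite_subset by auto
    define E' where "E' = {e'\<in>E. e \<inter> e' \<noteq> {}}"
    define N' where "N' = {g'\<in>N. g \<inter> g' \<noteq> {}}"
    have "{j \<in> E \<times> N. conflict (e, g) j} = E' \<times> N \<union> E \<times> N'"
      by (auto simp: conflict_def E'_def N'_def)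
    then have T: "card {j \<in> E \<times> N. conflict (e, g) j} \<le> card E' * card N + card E * card N'"
      by (metis card_Un_le card_cartesian_product)
    have E': "card E' \<le> k * \<Delta>"
      using card_meeting_le[of e 1 E \<Delta>] fin_eg e deg unfolding E'_def by auto
    have N': "(k - 1) * card N' \<le> k * ((n - 1 choose (k - 2)) * c)"
      using card_meeting_le[of g "k - 1" N "(n - 1 choose (k - 2)) * c"] fin_eg g N_deg
      unfolding N'_def by auto
    have "card E' * card N \<le> \<Delta> * (k * card N)"
      using mult_le_mono1[OF E', of "card N"] by (simp add: mult_ac)
    also have "\<dots> \<le> \<Delta> * (B * c)" using N_card by (rule mult_le_mono2)
    finally have t1: "card E' * card N \<le> \<Delta> * c * B" by (simp add: mult_ac)
    \<comment> \<open>The factor \<open>k - 1\<close> from the degree bound is carried along and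
      cancelled only after \<open>absorb\<close>; it is positive as
      \<open>k \<ge> 2\<close>.\<close>
    have "(k - 1) * (card E * card N') = card E * ((k - 1) * card N')" by (simp add: mult_ac)
    also have "\<dots> \<le> card E * (k * ((n - 1 choose (k - 2)) * c))"
      using N' by (rule mult_le_mono2)
    also have "\<dots> = (k * card E) * ((n - 1 choose (k - 2)) * c)" by (simp add: mult_ac)
    also have "\<dots> \<le> (\<Delta> * n) * ((n - 1 choose (k - 2)) * c)"
      using E_card by (rule mult_le_mono1)
    also have "\<dots> = \<Delta> * c * (n * (n - 1 choose (k - 2)))" by (simp add: mult_ac)
    also have "\<dots> = (k - 1) * (\<Delta> * c * B)" unfolding absorb[symmetric] by (simp add: mult_ac)
    finally have t2: "card E * card N' \<le> \<Delta> * c * B" using k by simp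
    have "k * (4 * card {j \<in> E \<times> N. conflict (e, g) j}) \<le> k * (4 * (2 * (\<Delta> * c * B)))"
      using T t1 t2 by (intro mult_le_mono2) linarith
    also have "\<dots> = (8 * \<Delta> * c * k) * B" by (simp add: mult_ac)
    also have "\<dots> \<le> (n - (k - 1)) * B" using small k by (intro mult_le_mono1) linarith
    also have "\<dots> = k * (n choose k)" by (rule choose[symmetric])
    finally show ?thesis using k by simp
  qed
  \<comment> \<open>Edges are nonempty. Hence \<open>p\<close> is a term of the conflict sum, and
    \<open>p \<le> 1/4\<close> follows from the sum bound.\<close>
  have self: "conflict i i" if "i \<in> E \<times> N" for i
    using that E k by (auto simp: conflict_def)
  have "\<Omega> - \<Union>(A ` (E \<times> N)) \<noteq> {}"
  proof (rule lopsided_local_lemma[where p = "\<lambda>_. p" and conflict = conflict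
        and A = A and I = "E \<times> N" and \<Omega> = \<Omega>])
    show "finite \<Omega>" unfolding \<Omega>_def using fin by (rule finite_bijections)
    show "\<Omega> \<noteq> {}" unfolding \<Omega>_def using fin card by (intro bijections_nonempty) simp_all
    show "finite (E \<times> N)" using finE finN by simp
    show sum: "(\<Sum>j | j \<in> E \<times> N \<and> conflict i j. p) \<le> 1/4" if "i \<in> E \<times> N" for i
    proof -
      obtain e g where i: "i = (e, g)" "e \<in> E" "g \<in> N" using \<open>i \<in> E \<times> N\<close> by auto
      have "real (4 * card {j \<in> E \<times> N. conflict i j}) \<le> real (n choose k)"
        using few[OF i(2,3)] unfolding i(1) of_nat_le_iff .
      then show ?thesis using nk by (simp add: p_def divide_simps)
    qed
    show "0 \<le> p \<and> p \<le> 1/4" if "i \<in> E \<times> N" for i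
    proof -
      have "0 \<le> p" by (simp add: p_def)
      have "p = (\<Sum>j\<in>{i}. p)" by simp
      also have "\<dots> \<le> (\<Sum>j | j \<in> E \<times> N \<and> conflict i j. p)"
        using that self[OF that] finE finN \<open>0 \<le> p\<close> by (intro sum_mono2) simp_all
      also have "\<dots> \<le> 1/4" using that by (rule sum)
      finally show ?thesis using \<open>0 \<le> p\<close> by blast
    qed
    show "real (card (A i \<inter> (\<Omega> - \<Union>(A ` S)))) \<le> p * real (card (\<Omega> - \<Union>(A ` S)))"
      if i: "i \<in> E \<times> N" and S: "S \<subseteq> E \<times> N" "\<forall>j\<in>S. \<not> conflict i j" for i S
    proof -
      obtain e g where eg: "i = (e, g)" "e \<in> E" "g \<in> N" using i by auto
      define X where "X = {f \<in> bijections V W. \<forall>(e', g')\<in>S. f ` e' \<noteq> g'}"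
      have X: "\<Omega> - \<Union>(A ` S) = X" by (auto simp: X_def A_def \<Omega>_def)
      have AX: "A i \<inter> X = {f \<in> X. f ` e = g}" by (auto simp: A_def eg X_def \<Omega>_def)
      have disj: "\<forall>(e', g')\<in>S. e' \<subseteq> V \<and> g' \<subseteq> W \<and> e \<inter> e' = {} \<and> g \<inter> g' = {}"
      proof (rule ballI)
        fix j assume "j \<in> S"
        then have "j \<in> E \<times> N" "\<not> conflict i j" using S by auto
        then show "case j of (e', g') \<Rightarrow> e' \<subseteq> V \<and> g' \<subseteq> W \<and> e \<inter> e' = {} \<and> g \<inter> g' = {}"
          using E N by (cases j) (simp add: eg(1) conflict_def)
      qed
      have "e \<subseteq> V" "card e = k" "g \<subseteq> W" "card g = k" using E N eg by simp_all
      from bijections_lopsided[OF fin this disj]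
      have "(card W choose k) * card {f \<in> X. f ` e = g} \<le> card X"
        unfolding X_def .
      then have "real (n choose k) * real (card (A i \<inter> X)) \<le> real (card X)"
        unfolding AX card of_nat_mult[symmetric] of_nat_le_iff .
      then show ?thesis
        unfolding X using nk by (simp add: p_def field_simps)
    qed
  qed
  then obtain f where "f \<in> \<Omega>" "f \<notin> \<Union>(A ` (E \<times> N))" by blast
  then show ?thesis by (intro exI[of _ f]) (auto simp: A_def \<Omega>_def bijections_def)
qed

section \<open>From codegree to embedding\<close>

text \<open>The \<open>k\<close>-sets containing \<open>S\<close> split into edges and non-edges,
  and there are \<open>card (verts H) - (k - 1)\<close> of them in total.\<close>

lemma card_nonedges_le:
  assumes H: "kgraph k H" "k \<ge> 1" "k - 1 \<le> card (verts H)"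
    and S: "S \<subseteq> verts H" "card S = k - 1"
  shows "card {g. g \<subseteq> verts H \<and> card g = k \<and> g \<notin> edges H \<and> S \<subseteq> g} + min_codegree k H
    \<le> card (verts H)"
proof -
  have fin: "finite (verts H)" using H by (simp add: kgraph_def)
  define D where "D = {g. S \<subseteq> g \<and> g \<subseteq> verts H \<and> card g = k}"
  have finD: "finite D" by (rule finite_subset[of _ "Pow (verts H)"]) (use fin in \<open>auto simp: D_def\<close>)
  have D: "D = {g. g \<subseteq> verts H \<and> card g = k \<and> g \<notin> edges H \<and> S \<subseteq> g} \<union> {e \<in> edges H. S \<subseteq> e}"
    using H by (auto simp: D_def kgraph_def)
  have "min_codegree k H \<le> card {e \<in> edges H. S \<subseteq> e}"
    using min_codegree_greatest[OF H(1,3)] S unfolding degree_def by blast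
  then have "card {g. g \<subseteq> verts H \<and> card g = k \<and> g \<notin> edges H \<and> S \<subseteq> g} + min_codegree k H \<le> card D"
    unfolding D using finD[unfolded D] by (subst card_Un_disjoint) auto
  also have "card D = card (verts H) - card S choose (k - card S)"
    unfolding D_def using fin S by (intro card_sets_between) auto
  also have "\<dots> \<le> card (verts H)" using S H by simp
  finally show ?thesis .
qed

theorem theorem8p1:
  fixes r k \<Delta> :: nat and \<alpha> :: real
  assumes "k \<ge> 2" and "r \<ge> k" and "\<Delta> > 0" and "\<alpha> > 0"
  defines "r' \<equiv> 36 * (r + 1) * (k - 1) * \<Delta>"
  shows "\<exists>n\<^sub>0::nat. \<forall>n\<ge>n\<^sub>0. \<forall>(G :: 'a hypergraph) (H :: 'b hypergraph).
    kgraph k G \<and> card (verts G) = n \<and> treewidth k G < r \<and> max_degree G \<le> \<Delta> \<and>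
    kgraph k H \<and> card (verts H) = n \<and>
    real (min_codegree k H) \<ge>
      (1 - 1 / real (((r' - 1) choose (k - 1)) + ((r' - 2) choose (k - 2))) + \<alpha>) * real n
    \<longrightarrow> contains_copy H G"
proof (intro exI[of _ "2 * k"] allI impI, elim conjE)
  fix n and G :: "'a hypergraph" and H :: "'b hypergraph"
  assume n: "2 * k \<le> n" and G: "kgraph k G" "card (verts G) = n" "max_degree G \<le> \<Delta>"
    and H: "kgraph k H" "card (verts H) = n"
    and codeg: "real (min_codegree k H) \<ge>
      (1 - 1 / real (((r' - 1) choose (k - 1)) + ((r' - 2) choose (k - 2))) + \<alpha>) * real n"
  \<comment> \<open>\<open>M\<close> is the denominator in the codegree condition; \<open>c\<close>
    will bound the number of non-edges on a \<open>(k - 1)\<close>-set.\<close>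
  define M where "M = ((r' - 1) choose (k - 1)) + ((r' - 2) choose (k - 2))"
  define c where "c = n - min_codegree k H"
  define N where "N = {g. g \<subseteq> verts H \<and> card g = k \<and> g \<notin> edges H}"
  have finV: "finite (verts G)" "finite (verts H)"
    using G H by (simp_all add: kgraph_def)
  have "36 * (k + 1) * 1 * \<Delta> \<le> r'"
    unfolding r'_def using assms by (intro mult_le_mono) auto
  then have "36 * (k * \<Delta>) + 36 * \<Delta> \<le> r'" by (simp add: algebra_simps)
  moreover have "k \<le> k * \<Delta>" "1 \<le> \<Delta>" using assms by simp_all
  moreover have "16 * \<Delta> * k = 16 * (k * \<Delta>)" by (simp add: mult_ac)
  ultimately have r': "16 * \<Delta> * k + 1 \<le> r'" "k < r' - 1"
    by linarith+
  have "16 * \<Delta> * k \<le> r' - 1" using r' by simp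
  \<comment> \<open>As \<open>0 < k - 1 < r' - 1\<close>, the first binomial coefficient alone is at
    least \<open>r' - 1\<close>.\<close>
  also have "\<dots> \<le> M"
    unfolding M_def using r' assms by (intro trans_le_add1 upper_le_binomial) auto
  finally have M: "16 * \<Delta> * k \<le> M" .
  have Mpos: "M > 0" using M assms by (auto intro: Nat.gr0I)
  \<comment> \<open>The codegree condition gives \<open>c \<le> n / M\<close>, as
    \<open>\<alpha> * n\<close> is nonnegative. In the other case truncated subtraction makes
    \<open>c\<close> zero.\<close>
  have "real c * M \<le> real n"
  proof (cases "min_codegree k H \<le> n")
    case True
    have "0 \<le> \<alpha> * real n" using assms by simp
    then have "real c \<le> real n / real M"
      using codeg True unfolding M_def[symmetric] c_def by (simp add: algebra_simps of_nat_diff)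
    then show ?thesis using Mpos by (simp add: field_simps)
  qed (simp add: c_def)
  then have "c * M \<le> n" by (metis of_nat_le_iff of_nat_mult)
  then have "c * (16 * \<Delta> * k) \<le> n" using M mult_le_mono2 order_trans by blast
  \<comment> \<open>Averaging \<open>16 * \<Delta> * c * k \<le> n\<close> and
    \<open>2 * k \<le> n\<close>; this explains the threshold \<open>2 * k\<close>.\<close>
  then have small: "8 * \<Delta> * c * k + k \<le> n + 1" using n by (simp add: mult_ac)
  have "\<exists>f. bij_betw f (verts G) (verts H) \<and> (\<forall>e\<in>edges G. f ` e \<notin> N)"
  proof (rule hypergraph_packing[OF assms(1) finV G(2) H(2) _ _ _ _ small])
    show "\<forall>e\<in>edges G. e \<subseteq> verts G \<and> card e = k" using G by (simp add: kgraph_def)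
    show "\<forall>g\<in>N. g \<subseteq> verts H \<and> card g = k" by (simp add: N_def)
    show "card {e \<in> edges G. v \<in> e} \<le> \<Delta>" if "v \<in> verts G" for v
    proof -
      have "degree G {v} \<le> max_degree G"
        unfolding max_degree_def using that finV by (intro Max_ge) auto
      then show ?thesis using G(3) by (simp add: degree_def)
    qed
    show "card {g \<in> N. S \<subseteq> g} \<le> c" if "S \<subseteq> verts H" "card S = k - 1" for S
    proof -
      have "k \<ge> 1" "k - 1 \<le> card (verts H)" using n assms(1) H(2) by simp_all
      from card_nonedges_le[OF H(1) this that] show ?thesis
        by (simp add: c_def N_def H(2) conj_assoc)
    qed
    show "k \<le> n" using n by simp
  qed
  then obtain f where f: "bij_betw f (verts G) (verts H)" "\<forall>e\<in>edges G. f ` e \<notin> N" by blast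
  have "f ` e \<in> edges H" if "e \<in> edges G" for e
  proof -
    have e: "e \<subseteq> verts G" "card e = k" using that G by (auto simp: kgraph_def)
    have "card (f ` e) = k" "f ` e \<subseteq> verts H"
      using e f(1) by (auto simp: bij_betw_def card_image inj_on_subset)
    then show ?thesis using f(2) that by (auto simp: N_def)
  qed
  then show "contains_copy H G"
    using f(1) unfolding contains_copy_def bij_betw_def by blast
qed

end
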